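(* Let $S$ be a discrete semigroup, let $\mathcal{F}$ be a filter on $S$ such that $\overline{\mathcal{F}}$ is a closed subsemigroup of $\beta S$, let $(X,\langle T_s\rangle_{s\in S})$ be a dynamical system and let $L$ be a minimal left ideal of $\overline{\mathcal{F}}$. (1) A subspace $Y$ of $X$ is minimal among all (nonempty) closed and $\mathcal{F}$-invariant subspaces of $X$ if and only if there is some $x\in X$ such that $Y=\{T_p(x): p\in L\}$. (2) Let $Y$ be a subspace of $X$ which is minimal among all (nonempty) closed and $\mathcal{F}$-invariant subspaces of $X$. Then every element of $Y$ is $\mathcal{F}$-uniformly recurrent. (3) If $x\in X$ is $\mathcal{F}$-uniformly recurrent and $Y=\{T_p(x): p\in\overline{\mathcal{F}}\}$, then $Y$ is minimal among all (nonempty) closed and $\mathcal{F}$-invariant subspaces of $X$. (4) If $x\in X$ is $\mathcal{F}$-uniformly recurrent then $T_p(x)$ is $\mathcal{F}$-uniformly recurrent for every $p\in\overline{\mathcal{F}}$.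
   Context: $\beta S$ is the space of ultrafilters on $S$. For $x\in S$, $A,G\subseteq S$ put $x^{-1}A=\{y\in S: xy\in A\}$ and $G^{-1}A=\bigcup_{x\in G}x^{-1}A$. The operation on $\beta S$: $A\in p\cdot q$ iff $\{x\in S: x^{-1}A\in q\}\in p$. $\overline{\mathcal{F}}=\{p\in\beta S:\mathcal{F}\subseteq p\}$, a compact right topological semigroup. A dynamical system $(X,\langle T_s\rangle_{s\in S})$ consists of a compact Hausdorff space $X$ and continuous maps $T_s:X\to X$ with $T_s\circ T_t=T_{st}$. For $p\in\beta S$, $T_p(x)=p\text{-}\lim_{s\in S}T_s(x)$; one has $T_p\circ T_q=T_{pq}$. A subspace $Z$ of $X$ is $\mathcal{F}$-invariant if $T_p(Z)\subseteq Z$ for every $p\in\overline{\mathcal{F}}$. A set $A\subseteq S$ is $\mathcal{F}$-syndetic if for every $V\in\mathcal{F}$ there is a finite $G\subseteq V$ with $G^{-1}A\in\mathcal{F}$. A point $x\in X$ is $\mathcal{F}$-uniformly recurrent if for each neighbourhood $W$ of $x$, $\{s\in S: T_s(x)\in W\}$ is $\mathcal{F}$-syndetic. *)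

theory Defs
  imports "HOL-Analysis.Analysis"
begin

text \<open>
  A filter on \<open>S\<close> is a library filter \<open>F :: 's filter\<close>; membership \<open>A \<in> F\<close> reads
  \<open>\<forall>\<^sub>F s in F. s \<in> A\<close>. The library order is reverse inclusion of the families of
  member sets, so \<open>F \<subseteq> p\<close> reads \<open>p \<le> F\<close>, and \<^const>\<open>bot\<close> is the improper filter.
\<close>

definition ultrafilter :: "'s filter \<Rightarrow> bool" where
  "ultrafilter p \<longleftrightarrow>
     p \<noteq> bot \<and> (\<forall>A. (\<forall>\<^sub>F s in p. s \<in> A) \<or> (\<forall>\<^sub>F s in p. s \<in> - A))"

definition beta :: "'s filter topology" where
  "beta = topology_generated_by (range (\<lambda>A. {p. ultrafilter p \<and> (\<forall>\<^sub>F s in p. s \<in> A)}))"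

definition left_quot :: "'s::semigroup_mult \<Rightarrow> 's set \<Rightarrow> 's set" where
  "left_quot x A = {y. x * y \<in> A}"

definition left_quots :: "'s::semigroup_mult set \<Rightarrow> 's set \<Rightarrow> 's set" where
  "left_quots G A = (\<Union>x\<in>G. left_quot x A)"

text \<open>
  A predicate \<open>P\<close> plays the role of the set \<^term>\<open>Collect P\<close>; the characterisation in terms of
  sets is \<open>mem_bmult\<close> below.
\<close>

definition bmult :: "'s::semigroup_mult filter \<Rightarrow> 's filter \<Rightarrow> 's filter"  (infixl "\<odot>" 70) where
  "p \<odot> q = Abs_filter (\<lambda>P. \<forall>\<^sub>F x in p. \<forall>\<^sub>F y in q. y \<in> left_quot x (Collect P))"

lemma eventually_bmult:
  "eventually P (p \<odot> q) \<longleftrightarrow> (\<forall>\<^sub>F x in p. \<forall>\<^sub>F y in q. P (x * y))"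
  unfolding bmult_def left_quot_def mem_Collect_eq
  by (subst eventually_Abs_filter, rule is_filter.intro)
    (auto elim: eventually_elim2 eventually_mono[OF _ eventually_mono])

lemma mem_bmult:
  "(\<forall>\<^sub>F s in p \<odot> q. s \<in> A) \<longleftrightarrow> (\<forall>\<^sub>F x in p. x \<in> {x. \<forall>\<^sub>F y in q. y \<in> left_quot x A})"
  by (simp add: eventually_bmult left_quot_def)

definition fbar :: "'s filter \<Rightarrow> 's filter set" where
  "fbar F = {p. ultrafilter p \<and> p \<le> F}"

definition closed_subsemigroup_beta :: "'s::semigroup_mult filter set \<Rightarrow> bool" where
  "closed_subsemigroup_beta E \<longleftrightarrow>
     E \<noteq> {} \<and> closedin beta E \<and> (\<forall>p\<in>E. \<forall>q\<in>E. p \<odot> q \<in> E)"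

definition left_ideal_of :: "'s::semigroup_mult filter set \<Rightarrow> 's filter set \<Rightarrow> bool" where
  "left_ideal_of E L \<longleftrightarrow> L \<noteq> {} \<and> L \<subseteq> E \<and> (\<forall>p\<in>E. \<forall>q\<in>L. p \<odot> q \<in> L)"

definition minimal_left_ideal_of :: "'s::semigroup_mult filter set \<Rightarrow> 's filter set \<Rightarrow> bool" where
  "minimal_left_ideal_of E L \<longleftrightarrow>
     left_ideal_of E L \<and> (\<forall>M. left_ideal_of E M \<and> M \<subseteq> L \<longrightarrow> M = L)"

definition dynamical_system :: "('s::semigroup_mult \<Rightarrow> 'x::t2_space \<Rightarrow> 'x) \<Rightarrow> bool" where
  "dynamical_system T \<longleftrightarrow>
     compact (UNIV :: 'x set) \<and> (\<forall>s. continuous_on UNIV (T s)) \<and>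
     (\<forall>s t. T s \<circ> T t = T (s * t))"

definition T_lim :: "('s \<Rightarrow> 'x::t2_space \<Rightarrow> 'x) \<Rightarrow> 's filter \<Rightarrow> 'x \<Rightarrow> 'x" where
  "T_lim T p x = Lim p (\<lambda>s. T s x)"

definition F_invariant :: "'s filter \<Rightarrow> ('s \<Rightarrow> 'x::t2_space \<Rightarrow> 'x) \<Rightarrow> 'x set \<Rightarrow> bool" where
  "F_invariant F T Z \<longleftrightarrow> (\<forall>p\<in>fbar F. T_lim T p ` Z \<subseteq> Z)"

definition minimal_closed_invariant ::
  "'s filter \<Rightarrow> ('s \<Rightarrow> 'x::t2_space \<Rightarrow> 'x) \<Rightarrow> 'x set \<Rightarrow> bool" where
  "minimal_closed_invariant F T Y \<longleftrightarrow>
     Y \<noteq> {} \<and> closed Y \<and> F_invariant F T Y \<and>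
     (\<forall>Z. Z \<noteq> {} \<and> closed Z \<and> F_invariant F T Z \<and> Z \<subseteq> Y \<longrightarrow> Z = Y)"

definition F_syndetic :: "'s::semigroup_mult filter \<Rightarrow> 's set \<Rightarrow> bool" where
  "F_syndetic F A \<longleftrightarrow>
     (\<forall>V. (\<forall>\<^sub>F s in F. s \<in> V) \<longrightarrow>
        (\<exists>G. finite G \<and> G \<subseteq> V \<and> (\<forall>\<^sub>F s in F. s \<in> left_quots G A)))"

definition F_uniformly_recurrent ::
  "'s::semigroup_mult filter \<Rightarrow> ('s \<Rightarrow> 'x::t2_space \<Rightarrow> 'x) \<Rightarrow> 'x \<Rightarrow> bool" where
  "F_uniformly_recurrent F T x \<longleftrightarrow>
     (\<forall>W. x \<in> interior W \<longrightarrow> F_syndetic F {s. T s x \<in> W})"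

end

theory Submission
  imports Defs
begin

text \<open>
  The orbit \<open>{T_p z | p \<in> fbar F}\<close> is the set of cluster points of \<open>s \<mapsto> T_s z\<close> along \<open>F\<close>, hence
  closed, and \<open>T_p \<circ> T_q = T_{pq}\<close> makes it invariant. Since \<open>L = fbar F \<odot> q\<close> for each \<open>q \<in> L\<close>, the
  sets \<open>{T_p x | p \<in> L}\<close> are orbits of points \<open>T_q x\<close>, and they are minimal because \<open>L\<close> is. A set \<open>A\<close>
  fails to be syndetic exactly when some \<open>V \<in> F\<close> and some \<open>p \<in> fbar F\<close> satisfy \<open>x\<inverse>A \<notin> p\<close> for all
  \<open>x \<in> V\<close>. So uniform recurrence of \<open>y\<close> amounts to \<open>y\<close> lying in the orbit of every \<open>T_p y\<close>.
\<close>

section \<open>Ultrafilters\<close>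

text \<open>Zorn's lemma gives a minimal proper filter below \<open>F\<close>. Meeting it with
  \<open>principal A\<close> yields either \<open>bot\<close>, so the complement of \<open>A\<close>
  is a member, or the filter itself, so \<open>A\<close> is a member.\<close>

lemma ex_ultrafilter_le:
  fixes F :: "'s filter"
  assumes "F \<noteq> bot"
  obtains p where "ultrafilter p" "p \<le> F"
proof -
  let ?A = "{q. q \<noteq> bot \<and> q \<le> F}"
  have "\<exists>p\<in>?A. \<forall>q\<in>?A. p \<ge> q \<longrightarrow> q = p"
  proof (rule predicate_Zorn)
    show "partial_order_on ?A (relation_of (\<ge>) ?A)"
      by (rule partial_order_on_relation_ofI) auto
  next
    fix C assume C: "C \<in> Chains (relation_of (\<ge>) ?A)"
    then have sub: "C \<subseteq> ?A" and chain: "\<And>a b. a \<in> C \<Longrightarrow> b \<in> C \<Longrightarrow> a \<le> b \<or> b \<le> a"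
      unfolding Chains_def relation_of_def by blast+
    show "\<exists>u\<in>?A. \<forall>a\<in>C. a \<ge> u"
    proof (cases "C = {}")
      case True
      then show ?thesis using assms by blast
    next
      case False
      \<comment> \<open>The infimum of a nonempty chain is the union of its families of members, so
        it is improper only if some filter of the chain is.\<close>
      have "eventually P (Inf C) \<longleftrightarrow> (\<exists>b\<in>C. eventually P b)" for P
      proof (rule eventually_Inf_base[OF False])
        fix a b assume "a \<in> C" "b \<in> C"
        then show "\<exists>c\<in>C. c \<le> inf a b"
          using chain[of a b] by (auto simp: inf_absorb1 inf_absorb2)
      qed
      then have "Inf C \<noteq> bot"
        using sub by (auto simp: trivial_limit_def)
      moreover have "Inf C \<le> F"
        using False sub by (auto intro: Inf_lower2)
      ultimately show ?thesis
        by (auto intro: Inf_lower)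
    qed
  qed
  then obtain p where p: "p \<noteq> bot" "p \<le> F" and min: "\<And>q. q \<noteq> bot \<Longrightarrow> q \<le> p \<Longrightarrow> q = p"
    by (blast intro: order_trans)
  have "(\<forall>\<^sub>F s in p. s \<in> A) \<or> (\<forall>\<^sub>F s in p. s \<in> - A)" for A
  proof (cases "inf p (principal A) = bot")
    case True
    then have "\<forall>\<^sub>F s in p. s \<in> - A"
      by (simp add: trivial_limit_def eventually_inf_principal)
    then show ?thesis ..
  next
    case False
    then have "inf p (principal A) = p"
      by (rule min) simp
    then have "p \<le> principal A"
      by (metis inf.cobounded2)
    then show ?thesis
      by (simp add: le_principal)
  qed
  with p show thesis
    by (intro that) (auto simp: ultrafilter_def)
qed

lemma ultrafilter_frequently_iff:
  assumes "ultrafilter p"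
  shows "(\<exists>\<^sub>F s in p. P s) \<longleftrightarrow> (\<forall>\<^sub>F s in p. P s)"
proof
  show "\<exists>\<^sub>F s in p. P s \<Longrightarrow> \<forall>\<^sub>F s in p. P s"
    using assms unfolding ultrafilter_def frequently_def
    by (drule_tac conjunct2, drule_tac spec[of _ "Collect P"]) simp
  show "\<forall>\<^sub>F s in p. P s \<Longrightarrow> \<exists>\<^sub>F s in p. P s"
    using assms eventually_frequently ultrafilter_def by blast
qed

text \<open>This is the source of all ultrafilters in \<open>fbar F\<close> with prescribed members:
  the hypothesis says that every member of \<open>H\<close> meets every member of \<open>F\<close>,
  so \<open>inf F H\<close> is proper.\<close>

lemma ex_fbar_le:
  assumes "\<And>P. eventually P H \<Longrightarrow> \<exists>\<^sub>F s in F. P s"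
  obtains p where "p \<in> fbar F" "p \<le> H"
proof -
  have "inf F H \<noteq> bot"
  proof
    assume "inf F H = bot"
    then have "eventually (\<lambda>_. False) (inf F H)"
      by simp
    then obtain Q R where "eventually Q F" "eventually R H" "\<And>x. \<not> (Q x \<and> R x)"
      unfolding eventually_inf by blast
    then show False
      using assms[of R] unfolding frequently_def by (metis (mono_tags, lifting) eventually_mono)
  qed
  then obtain p where "ultrafilter p" "p \<le> inf F H"
    by (rule ex_ultrafilter_le)
  then show thesis
    by (intro that) (auto simp: fbar_def)
qed

text \<open>Compactness gives a cluster point of the image filter. It is a limit, since a
  neighbourhood whose preimage is not in \<open>p\<close> has its complement's preimage in
  \<open>p\<close>.\<close>

lemma ultrafilter_convergent:
  fixes f :: "'s \<Rightarrow> 'x::topological_space"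
  assumes "ultrafilter p" "compact (UNIV :: 'x set)"
  obtains x where "(f \<longlongrightarrow> x) p"
proof -
  have "filtermap f p \<noteq> bot"
    using assms(1) by (simp add: ultrafilter_def filtermap_bot_iff)
  then obtain x where x: "inf (nhds x) (filtermap f p) \<noteq> bot"
    using assms(2) unfolding compact_filter by auto
  have "\<forall>\<^sub>F s in p. f s \<in> U" if "open U" "x \<in> U" for U
  proof (rule ccontr)
    assume "\<not> (\<forall>\<^sub>F s in p. f s \<in> U)"
    then have "\<forall>\<^sub>F s in p. f s \<notin> U"
      using ultrafilter_frequently_iff[OF assms(1)] by (metis not_eventually)
    then have "eventually (\<lambda>y. y \<notin> U) (filtermap f p)"
      by (simp add: eventually_filtermap)
    moreover have "eventually (\<lambda>y. y \<in> U) (nhds x)"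
      using that by (rule eventually_nhds_in_open)
    ultimately have "eventually (\<lambda>_. False) (inf (nhds x) (filtermap f p))"
      unfolding eventually_inf by blast
    with x show False
      by (simp add: trivial_limit_def)
  qed
  then show thesis
    by (intro that topological_tendstoI)
qed

lemma ex_fbar_tendsto_iff:
  fixes f :: "'s \<Rightarrow> 'x::topological_space"
  shows "(\<exists>p\<in>fbar F. (f \<longlongrightarrow> y) p) \<longleftrightarrow> (\<forall>U. open U \<and> y \<in> U \<longrightarrow> (\<exists>\<^sub>F s in F. f s \<in> U))"
proof (intro iffI allI impI)
  fix U assume "\<exists>p\<in>fbar F. (f \<longlongrightarrow> y) p" "open U \<and> y \<in> U"
  then obtain p where p: "ultrafilter p" "p \<le> F" "\<forall>\<^sub>F s in p. f s \<in> U"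
    unfolding fbar_def by (auto dest: topological_tendstoD)
  then have "\<exists>\<^sub>F s in p. f s \<in> U"
    by (simp add: ultrafilter_frequently_iff)
  with p(2) show "\<exists>\<^sub>F s in F. f s \<in> U"
    unfolding frequently_def by (blast dest: filter_leD)
next
  assume U: "\<forall>U. open U \<and> y \<in> U \<longrightarrow> (\<exists>\<^sub>F s in F. f s \<in> U)"
  \<comment> \<open>Lying below the pullback of \<open>nhds y\<close> is the same as
    \<open>f\<close> tending to \<open>y\<close>.\<close>
  obtain p where "p \<in> fbar F" "p \<le> filtercomap f (nhds y)"
  proof (rule ex_fbar_le)
    fix P assume "eventually P (filtercomap f (nhds y))"
    then obtain U where "open U" "y \<in> U" "\<And>s. f s \<in> U \<Longrightarrow> P s"
      unfolding eventually_filtercomap eventually_nhds by blast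
    moreover from this U have "\<exists>\<^sub>F s in F. f s \<in> U"
      by blast
    ultimately show "\<exists>\<^sub>F s in F. P s"
      by (metis (mono_tags) frequently_elim1)
  qed
  then show "\<exists>p\<in>fbar F. (f \<longlongrightarrow> y) p"
    by (auto simp: filterlim_def filtermap_le_iff_le_filtercomap)
qed

text \<open>If no finite \<open>G\<close> inside \<open>V\<close> works, the complements of finitely
  many left quotients by elements of \<open>V\<close> always meet the members of \<open>F\<close>,
  so one ultrafilter contains all these complements at once.\<close>

lemma not_F_syndeticE:
  assumes "\<not> F_syndetic F A"
  obtains V p where "\<forall>\<^sub>F s in F. s \<in> V" "p \<in> fbar F"
    "\<And>x. x \<in> V \<Longrightarrow> \<forall>\<^sub>F s in p. x * s \<notin> A"
proof -
  obtain V where V: "\<forall>\<^sub>F s in F. s \<in> V"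
    and G: "\<And>G. finite G \<Longrightarrow> G \<subseteq> V \<Longrightarrow> \<not> (\<forall>\<^sub>F s in F. s \<in> left_quots G A)"
    using assms unfolding F_syndetic_def by blast
  obtain p where p: "p \<in> fbar F" "p \<le> (INF x\<in>V. principal {s. x * s \<notin> A})"
  proof (rule ex_fbar_le)
    fix P assume "eventually P (INF x\<in>V. principal {s. x * s \<notin> A})"
    then obtain G where "G \<subseteq> V" "finite G" "eventually P (INF x\<in>G. principal {s. x * s \<notin> A})"
      unfolding eventually_INF[of _ _ V] by blast
    then have "\<exists>\<^sub>F s in F. s \<notin> left_quots G A" "\<And>s. s \<notin> left_quots G A \<Longrightarrow> P s"
      using G[of G] by (simp_all add: not_eventually INF_principal_finite eventually_principal
          left_quots_def left_quot_def)
    then show "\<exists>\<^sub>F s in F. P s"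
      by (meson frequently_elim1)
  qed
  have "\<forall>\<^sub>F s in p. x * s \<notin> A" if "x \<in> V" for x
  proof -
    have "p \<le> principal {s. x * s \<notin> A}"
      using p(2) that by (meson INF_lower order_trans)
    then show ?thesis
      by (simp add: le_principal)
  qed
  with V p(1) show thesis
    by (rule that)
qed

text \<open>By associativity the right-hand side is a left ideal, and it lies in \<open>L\<close>
  because \<open>q\<close> does; minimality forces equality.\<close>

lemma minimal_left_ideal_eq_mult:
  assumes L: "minimal_left_ideal_of E L" and "q \<in> L"
    and E: "E \<noteq> {}" "\<And>p q. p \<in> E \<Longrightarrow> q \<in> E \<Longrightarrow> p \<odot> q \<in> E"
  shows "L = (\<lambda>p. p \<odot> q) ` E"
proof -
  have assoc: "p \<odot> (r \<odot> q) = (p \<odot> r) \<odot> q" for p r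
    by (simp add: filter_eq_iff eventually_bmult mult.assoc)
  have left: "left_ideal_of E L"
    using L unfolding minimal_left_ideal_of_def by blast
  then have sub: "(\<lambda>p. p \<odot> q) ` E \<subseteq> L"
    using \<open>q \<in> L\<close> unfolding left_ideal_of_def by blast
  have "left_ideal_of E ((\<lambda>p. p \<odot> q) ` E)"
    unfolding left_ideal_of_def
  proof (intro conjI ballI)
    show "(\<lambda>p. p \<odot> q) ` E \<noteq> {}"
      using E(1) by blast
    show "(\<lambda>p. p \<odot> q) ` E \<subseteq> E"
      using left sub unfolding left_ideal_of_def by blast
    fix p r assume "p \<in> E" "r \<in> (\<lambda>p. p \<odot> q) ` E"
    then show "p \<odot> r \<in> (\<lambda>p. p \<odot> q) ` E"
      using E(2) assoc by auto
  qed
  with L sub show ?thesis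
    unfolding minimal_left_ideal_of_def by blast
qed

section \<open>Orbits under the closed semigroup of a filter\<close>

context
  fixes F :: "'s::semigroup_mult filter"
    and T :: "'s \<Rightarrow> 'x::t2_space \<Rightarrow> 'x"
  assumes sys: "dynamical_system T"
begin

section \<open>Limits of the action along ultrafilters\<close>

lemma tendsto_T_lim:
  assumes "ultrafilter p"
  shows "((\<lambda>s. T s x) \<longlongrightarrow> T_lim T p x) p"
proof -
  obtain y where y: "((\<lambda>s. T s x) \<longlongrightarrow> y) p"
    using ultrafilter_convergent[OF assms] sys unfolding dynamical_system_def by metis
  moreover have "p \<noteq> bot"
    using assms by (simp add: ultrafilter_def)
  ultimately show ?thesis
    unfolding T_lim_def by (metis tendsto_Lim)
qed

lemma T_lim_eq_iff:
  assumes "ultrafilter p"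
  shows "T_lim T p x = y \<longleftrightarrow> ((\<lambda>s. T s x) \<longlongrightarrow> y) p"
  using tendsto_T_lim[OF assms] assms tendsto_unique unfolding ultrafilter_def by blast

text \<open>Only the continuity of a single \<open>T s\<close> enters; the maps
  \<open>T_lim T p\<close> need not be continuous.\<close>

lemma tendsto_T_mult:
  assumes "ultrafilter q"
  shows "((\<lambda>t. T (s * t) x) \<longlongrightarrow> T s (T_lim T q x)) q"
proof -
  have "isCont (T s) (T_lim T q x)"
    using sys unfolding dynamical_system_def by (simp add: continuous_on_eq_continuous_at)
  then have "((\<lambda>t. T s (T t x)) \<longlongrightarrow> T s (T_lim T q x)) q"
    by (rule isCont_tendsto_compose) (rule tendsto_T_lim[OF assms])
  moreover have "T s (T t x) = T (s * t) x" for t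
    using sys unfolding dynamical_system_def by (metis comp_apply)
  ultimately show ?thesis
    by simp
qed

text \<open>Membership in an open \<open>U\<close> passes through both limits, and
  \<open>eventually_bmult\<close> turns the iterated statement into one about the product. For
  \<open>p\<close>, \<open>q\<close> in \<open>fbar F\<close> the third hypothesis will follow from
  closure under products.\<close>

lemma T_lim_bmult:
  assumes "ultrafilter p" "ultrafilter q" "ultrafilter (p \<odot> q)"
  shows "T_lim T (p \<odot> q) x = T_lim T p (T_lim T q x)"
  unfolding T_lim_eq_iff[OF assms(3)]
proof (rule topological_tendstoI)
  fix U assume U: "open U" "T_lim T p (T_lim T q x) \<in> U"
  have "\<forall>\<^sub>F s in p. T s (T_lim T q x) \<in> U"
    using tendsto_T_lim[OF assms(1)] U by (rule topological_tendstoD)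
  then have "\<forall>\<^sub>F s in p. \<forall>\<^sub>F t in q. T (s * t) x \<in> U"
    by (rule eventually_mono) (rule topological_tendstoD[OF tendsto_T_mult[OF assms(2)] U(1)])
  then show "\<forall>\<^sub>F s in p \<odot> q. T s x \<in> U"
    by (simp add: eventually_bmult)
qed

section \<open>Orbits as sets of cluster points\<close>

definition orbit :: "'x \<Rightarrow> 'x set" where
  "orbit z = {T_lim T p z | p. p \<in> fbar F}"

text \<open>This description mentions no ultrafilter and makes closedness immediate: an open
  \<open>U\<close> that excludes one point from the orbit excludes all of its points.\<close>

lemma mem_orbit_iff:
  "y \<in> orbit z \<longleftrightarrow> (\<forall>U. open U \<and> y \<in> U \<longrightarrow> (\<exists>\<^sub>F s in F. T s z \<in> U))"
proof -
  have "y \<in> orbit z \<longleftrightarrow> (\<exists>p\<in>fbar F. T_lim T p z = y)"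
    unfolding orbit_def by blast
  also have "\<dots> \<longleftrightarrow> (\<exists>p\<in>fbar F. ((\<lambda>s. T s z) \<longlongrightarrow> y) p)"
    by (simp add: T_lim_eq_iff fbar_def)
  finally show ?thesis
    unfolding ex_fbar_tendsto_iff .
qed

lemma closed_orbit: "closed (orbit z)"
  unfolding closed_def
proof (subst open_subopen, intro ballI)
  fix y assume "y \<in> - orbit z"
  then obtain U where "open U" "y \<in> U" "\<not> (\<exists>\<^sub>F s in F. T s z \<in> U)"
    unfolding Compl_iff mem_orbit_iff by blast
  then show "\<exists>U. open U \<and> y \<in> U \<and> U \<subseteq> - orbit z"
    by (intro exI[of _ U]) (auto simp: mem_orbit_iff)
qed

lemma F_invariant_iff: "F_invariant F T Z \<longleftrightarrow> (\<forall>z\<in>Z. orbit z \<subseteq> Z)"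
  unfolding F_invariant_def orbit_def by blast

section \<open>Minimal sets, minimal left ideals and uniform recurrence\<close>

context
  assumes sub: "closed_subsemigroup_beta (fbar F)"
begin

lemma fbar_bmult: "p \<in> fbar F \<Longrightarrow> q \<in> fbar F \<Longrightarrow> p \<odot> q \<in> fbar F"
  using sub unfolding closed_subsemigroup_beta_def by blast

lemma fbar_nonempty: "fbar F \<noteq> {}"
  using sub unfolding closed_subsemigroup_beta_def by blast

lemma T_lim_bmult_fbar:
  "p \<in> fbar F \<Longrightarrow> q \<in> fbar F \<Longrightarrow> T_lim T (p \<odot> q) x = T_lim T p (T_lim T q x)"
  using fbar_bmult by (intro T_lim_bmult) (auto simp: fbar_def)

lemma orbit_nonempty: "orbit z \<noteq> {}"
  using fbar_nonempty unfolding orbit_def by blast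

lemma F_invariant_orbit: "F_invariant F T (orbit z)"
proof -
  have "T_lim T p (T_lim T q z) \<in> orbit z" if "p \<in> fbar F" "q \<in> fbar F" for p q
    using that fbar_bmult T_lim_bmult_fbar[of p q z, symmetric] unfolding orbit_def by blast
  then show ?thesis
    unfolding F_invariant_def by (auto simp: orbit_def)
qed

text \<open>Orbits are nonempty, closed and invariant, so a minimal set equals the orbit of each of
  its points. Conversely, a nonempty invariant subset contains the orbit of one of its points, hence
  everything.\<close>

lemma minimal_closed_invariant_iff:
  "minimal_closed_invariant F T Y \<longleftrightarrow> Y \<noteq> {} \<and> (\<forall>y\<in>Y. orbit y = Y)"
proof
  assume Y: "minimal_closed_invariant F T Y"
  then have "Y \<noteq> {}" and sub: "\<And>y. y \<in> Y \<Longrightarrow> orbit y \<subseteq> Y"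
    unfolding minimal_closed_invariant_def F_invariant_iff by blast+
  moreover have "orbit y = Y" if "y \<in> Y" for y
  proof -
    have "\<forall>Z. Z \<noteq> {} \<and> closed Z \<and> F_invariant F T Z \<and> Z \<subseteq> Y \<longrightarrow> Z = Y"
      using Y unfolding minimal_closed_invariant_def by (elim conjE)
    then show ?thesis
      using sub[OF that] closed_orbit orbit_nonempty F_invariant_orbit by simp
  qed
  ultimately show "Y \<noteq> {} \<and> (\<forall>y\<in>Y. orbit y = Y)"
    by blast
next
  assume Y: "Y \<noteq> {} \<and> (\<forall>y\<in>Y. orbit y = Y)"
  then have "closed Y"
    using closed_orbit by (metis ex_in_conv)
  moreover have "Z = Y" if "Z \<noteq> {}" "F_invariant F T Z" "Z \<subseteq> Y" for Z
    using that Y unfolding F_invariant_iff by blast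
  ultimately show "minimal_closed_invariant F T Y"
    using Y unfolding minimal_closed_invariant_def F_invariant_iff by blast
qed

lemma minimal_left_ideal_orbit:
  assumes L: "minimal_left_ideal_of (fbar F) L" and "q \<in> L"
  shows "orbit (T_lim T q x) = {T_lim T p x | p. p \<in> L}"
proof -
  have q: "q \<in> fbar F"
    using assms unfolding minimal_left_ideal_of_def left_ideal_of_def by blast
  have "L = (\<lambda>p. p \<odot> q) ` fbar F"
    using assms fbar_nonempty fbar_bmult by (rule minimal_left_ideal_eq_mult)
  then have "{T_lim T p x | p. p \<in> L} = {T_lim T (p \<odot> q) x | p. p \<in> fbar F}"
    by blast
  also have "\<dots> = orbit (T_lim T q x)"
    unfolding orbit_def using T_lim_bmult_fbar[OF _ q, of _ x] by force
  finally show ?thesis ..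
qed

lemma minimal_closed_invariant_iff_left_ideal:
  assumes L: "minimal_left_ideal_of (fbar F) L"
  shows "minimal_closed_invariant F T Y \<longleftrightarrow> (\<exists>x. Y = {T_lim T p x | p. p \<in> L})"
proof
  obtain q where q: "q \<in> L" "q \<in> fbar F"
    using L unfolding minimal_left_ideal_of_def left_ideal_of_def by blast
  {
    assume "minimal_closed_invariant F T Y"
    then obtain y where "y \<in> Y" and orb: "\<And>y. y \<in> Y \<Longrightarrow> orbit y = Y"
      unfolding minimal_closed_invariant_iff by blast
    \<comment> \<open>The orbit of this point is \<open>Y\<close> by minimality and the image of
      \<open>L\<close> at \<open>y\<close> by the previous lemma, so \<open>y\<close> is the
      required witness.\<close>
    then have "T_lim T q y \<in> Y"
      using q(2) unfolding orbit_def by blast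
    then show "\<exists>x. Y = {T_lim T p x | p. p \<in> L}"
      using orb minimal_left_ideal_orbit[OF L q(1)] by metis
  next
    assume "\<exists>x. Y = {T_lim T p x | p. p \<in> L}"
    then obtain x where Y: "Y = {T_lim T p x | p. p \<in> L}"
      by blast
    then have "\<forall>y\<in>Y. orbit y = Y"
      using minimal_left_ideal_orbit[OF L] by blast
    moreover have "Y \<noteq> {}"
      using Y q(1) by blast
    ultimately show "minimal_closed_invariant F T Y"
      by (simp add: minimal_closed_invariant_iff)
  }
qed

text \<open>Both directions compare the values \<open>T (g * s) x\<close>, for \<open>s\<close>
  along \<open>p\<close>, with their limit \<open>T g (T_lim T p x)\<close>.\<close>

lemma F_uniformly_recurrent_iff:
  "F_uniformly_recurrent F T x \<longleftrightarrow> (\<forall>p\<in>fbar F. x \<in> orbit (T_lim T p x))"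
proof (intro iffI ballI)
  fix p assume rec: "F_uniformly_recurrent F T x" and "p \<in> fbar F"
  then have p: "ultrafilter p" "p \<le> F"
    by (auto simp: fbar_def)
  show "x \<in> orbit (T_lim T p x)"
    unfolding mem_orbit_iff
  proof (intro allI impI)
    fix O' assume O: "open O' \<and> x \<in> O'"
    \<comment> \<open>Regularity shrinks \<open>O'\<close> to \<open>U\<close> and puts the
      complement of \<open>O'\<close> into an open \<open>U'\<close> disjoint from \<open>U\<close>:
      a limit outside \<open>O'\<close> then forces nearby values out of \<open>U\<close>.\<close>
    have "Hausdorff_space (euclidean :: 'x topology)"
      unfolding Hausdorff_space_def disjnt_def by simp (meson hausdorff)
    moreover have "compact_space (euclidean :: 'x topology)"
      using sys unfolding dynamical_system_def compact_space_def by simp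
    ultimately have "regular_space (euclidean :: 'x topology)"
      by (intro compact_Hausdorff_imp_regular_space)
    then obtain U U' where U: "open U" "x \<in> U" and U': "open U'" "- O' \<subseteq> U'" "U \<inter> U' = {}"
      using O unfolding regular_space_def disjnt_def
      by (simp add: closed_closedin[symmetric] open_openin[symmetric])
        (metis Compl_iff closed_Compl)
    show "\<exists>\<^sub>F s in F. T s (T_lim T p x) \<in> O'"
      unfolding frequently_def
    proof
      assume "\<forall>\<^sub>F s in F. T s (T_lim T p x) \<notin> O'"
      \<comment> \<open>This set serves as \<open>V\<close> in the definition of syndeticity, so
        that every \<open>g\<close> in \<open>G\<close> sends \<open>T_lim T p x\<close> outside
        \<open>O'\<close>.\<close>
      then have "\<forall>\<^sub>F s in F. s \<in> {s. T s (T_lim T p x) \<notin> O'}"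
        by simp
      moreover have "F_syndetic F {s. T s x \<in> U}"
        using rec U unfolding F_uniformly_recurrent_def by (simp add: interior_open)
      ultimately obtain G where "finite G" and G: "G \<subseteq> {s. T s (T_lim T p x) \<notin> O'}"
        and "\<forall>\<^sub>F s in F. s \<in> left_quots G {s. T s x \<in> U}"
        unfolding F_syndetic_def by metis
      then have "\<forall>\<^sub>F s in p. \<exists>g\<in>G. T (g * s) x \<in> U"
        using p(2) by (auto simp: left_quots_def left_quot_def dest: filter_leD)
      \<comment> \<open>Finiteness of \<open>G\<close> allows one member of \<open>p\<close> to
        serve all \<open>g\<close> simultaneously.\<close>
      moreover have "\<forall>\<^sub>F s in p. \<forall>g\<in>G. T (g * s) x \<in> U'"
      proof (rule eventually_ball_finite[OF \<open>finite G\<close>], intro ballI)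
        fix g assume "g \<in> G"
        then have "T g (T_lim T p x) \<in> U'"
          using G U'(2) by blast
        then show "\<forall>\<^sub>F s in p. T (g * s) x \<in> U'"
          using tendsto_T_mult[OF p(1)] U'(1) by (metis topological_tendstoD)
      qed
      ultimately have "\<forall>\<^sub>F s in p. False"
        by eventually_elim (use U'(3) in blast)
      with p(1) show False
        by (simp add: ultrafilter_def trivial_limit_def)
    qed
  qed
next
  assume orb: "\<forall>p\<in>fbar F. x \<in> orbit (T_lim T p x)"
  show "F_uniformly_recurrent F T x"
    unfolding F_uniformly_recurrent_def
  proof (intro allI impI, rule ccontr)
    fix W assume W: "x \<in> interior W" and "\<not> F_syndetic F {s. T s x \<in> W}"
    then obtain V p where V: "\<forall>\<^sub>F s in F. s \<in> V" and p: "p \<in> fbar F"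
      and avoid: "\<And>g. g \<in> V \<Longrightarrow> \<forall>\<^sub>F s in p. T (g * s) x \<notin> W"
      by (elim not_F_syndeticE) simp
    have up: "ultrafilter p"
      using p by (simp add: fbar_def)
    \<comment> \<open>Return to \<open>W\<close> is frequent along \<open>F\<close>, so it happens
      for some \<open>g\<close> in \<open>V\<close>; the limit along \<open>p\<close> then
      contradicts \<open>avoid\<close>.\<close>
    have "\<exists>\<^sub>F g in F. T g (T_lim T p x) \<in> interior W"
      using orb p W unfolding mem_orbit_iff by simp
    then have "\<exists>\<^sub>F g in F. T g (T_lim T p x) \<in> interior W \<and> g \<in> V"
      using V by (rule frequently_eventually_frequently)
    then obtain g where g: "g \<in> V" "T g (T_lim T p x) \<in> interior W"
      by (auto dest: frequently_ex)
    have "\<forall>\<^sub>F s in p. T (g * s) x \<in> interior W"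
      using tendsto_T_mult[OF up] open_interior g(2) by (rule topological_tendstoD)
    with avoid[OF g(1)] have "\<forall>\<^sub>F s in p. False"
      by eventually_elim (use interior_subset in blast)
    with up show False
      by (simp add: ultrafilter_def trivial_limit_def)
  qed
qed

lemma F_uniformly_recurrent_if_minimal:
  assumes "minimal_closed_invariant F T Y" "y \<in> Y"
  shows "F_uniformly_recurrent F T y"
  unfolding F_uniformly_recurrent_iff
proof
  fix p assume "p \<in> fbar F"
  then have "T_lim T p y \<in> orbit y"
    unfolding orbit_def by blast
  with assms show "y \<in> orbit (T_lim T p y)"
    unfolding minimal_closed_invariant_iff by metis
qed

text \<open>Recurrence makes orbit membership symmetric: each \<open>y\<close> in the orbit of
  \<open>x\<close> has \<open>x\<close> in its own orbit, and invariance gives both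
  inclusions.\<close>

lemma minimal_orbit_if_F_uniformly_recurrent:
  assumes "F_uniformly_recurrent F T x"
  shows "minimal_closed_invariant F T (orbit x)"
  unfolding minimal_closed_invariant_iff
proof (intro conjI ballI orbit_nonempty)
  fix y assume y: "y \<in> orbit x"
  then have "x \<in> orbit y"
    using assms unfolding F_uniformly_recurrent_iff orbit_def[of x] by blast
  with y show "orbit y = orbit x"
    using F_invariant_orbit unfolding F_invariant_iff by blast
qed

end

end

theorem lemma6p4:
  fixes F :: "'s::semigroup_mult filter"
    and T :: "'s \<Rightarrow> 'x::t2_space \<Rightarrow> 'x"
    and L :: "'s filter set"
  assumes "F \<noteq> bot"
    and "closed_subsemigroup_beta (fbar F)"
    and "dynamical_system T"
    and "minimal_left_ideal_of (fbar F) L"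
  shows "(\<forall>Y. minimal_closed_invariant F T Y \<longleftrightarrow> (\<exists>x. Y = {T_lim T p x | p. p \<in> L}))
    \<and> (\<forall>Y. minimal_closed_invariant F T Y \<longrightarrow> (\<forall>y\<in>Y. F_uniformly_recurrent F T y))
    \<and> (\<forall>x Y. F_uniformly_recurrent F T x \<and> Y = {T_lim T p x | p. p \<in> fbar F}
          \<longrightarrow> minimal_closed_invariant F T Y)
    \<and> (\<forall>x. F_uniformly_recurrent F T x
          \<longrightarrow> (\<forall>p\<in>fbar F. F_uniformly_recurrent F T (T_lim T p x)))"
proof (intro conjI allI impI ballI; (elim conjE)?)
  note sys = assms(3,2)
  show "minimal_closed_invariant F T Y \<longleftrightarrow> (\<exists>x. Y = {T_lim T p x | p. p \<in> L})" for Y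
    using sys assms(4) by (rule minimal_closed_invariant_iff_left_ideal)
  show "F_uniformly_recurrent F T y" if "minimal_closed_invariant F T Y" "y \<in> Y" for Y y
    using sys that by (rule F_uniformly_recurrent_if_minimal)
  show min: "minimal_closed_invariant F T Y"
    if "F_uniformly_recurrent F T x" "Y = {T_lim T p x | p. p \<in> fbar F}" for x Y
    using minimal_orbit_if_F_uniformly_recurrent[OF sys that(1)] that(2)
    by (simp add: orbit_def[OF sys(1)])
  \<comment> \<open>The point lies in the orbit of \<open>x\<close>, which is minimal by the
    preceding claim, and all points of a minimal set are recurrent.\<close>
  show "F_uniformly_recurrent F T (T_lim T p x)"
    if "F_uniformly_recurrent F T x" "p \<in> fbar F" for x p
    using sys min[OF that(1) refl] by (rule F_uniformly_recurrent_if_minimal) (use that(2) in blast)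
qed

end
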